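(* For every integer $n\ge 5$, the modular product $P_n\diamond P_n$ satisfies $$\mathrm{tww}(P_n\diamond P_n)\ge n+1,$$ where $P_n$ is the path on $n$ vertices.
   Context: All graphs are finite and simple (no loops or multiple edges). Twin-width. A trigraph $G$ has a vertex set $V(G)$, a set $E(G)$ of black edges and a set $R(G)$ of red edges, with $E(G)\cap R(G)=\emptyset$; a graph is a trigraph with no red edges. $N_G(v)$ is the set of vertices joined to $v$ by a black or red edge. A $d$-trigraph is a trigraph in which every vertex is incident with at most $d$ red edges. A contraction merges two distinct (not necessarily adjacent) vertices $u,v$ into a new vertex $w$: every vertex other than $u,v$ in $N_G(u)\triangle N_G(v)$ is joined to $w$ by a red edge; every $x\in N_G(u)\cap N_G(v)$ is joined to $w$ by a black edge if $ux,vx\in E(G)$ and by a red edge otherwise; all edges not incident with $u$ or $v$ are unchanged, and $u,v$ and their incident edges are removed. A $d$-sequence of an $n$-vertex graph $G$ is a sequence of $d$-trigraphs $G_n=G,G_{n-1},\dots,G_1=K_1$ with each $G_{i-1}$ obtained from $G_i$ by one contraction. The twin-width $\mathrm{tww}(G)$ is the least $d$ such that $G$ admits a $d$-sequence. Modular product. $G\diamond H$ has vertex set $V(G)\times V(H)$; $(u,i)(v,j)$ is an edge iff $u\ne v$, $i\ne j$, and either [$uv\in E(G)$ and $ij\in E(H)$] or [$uv\notin E(G)$ and $ij\notin E(H)$]. *)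

theory Defs
  imports Main
begin

text \<open>Edges are two-element sets of vertices. A graph is a trigraph without red edges, so graphs and
  trigraphs share one record type.\<close>

record 'a trigraph =
  verts :: "'a set"
  black :: "'a set set"
  red :: "'a set set"

definition is_trigraph :: "'a trigraph \<Rightarrow> bool" where
  "is_trigraph G \<longleftrightarrow>
     finite (verts G) \<and>
     black G \<subseteq> {{x, y} | x y. x \<in> verts G \<and> y \<in> verts G \<and> x \<noteq> y} \<and>
     red G \<subseteq> {{x, y} | x y. x \<in> verts G \<and> y \<in> verts G \<and> x \<noteq> y} \<and>
     black G \<inter> red G = {}"

definition is_graph :: "'a trigraph \<Rightarrow> bool" where
  "is_graph G \<longleftrightarrow> is_trigraph G \<and> red G = {}"

definition nbrs :: "'a trigraph \<Rightarrow> 'a \<Rightarrow> 'a set" where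
  "nbrs G v = {x \<in> verts G. {v, x} \<in> black G \<union> red G}"

definition d_trigraph :: "nat \<Rightarrow> 'a trigraph \<Rightarrow> bool" where
  "d_trigraph d G \<longleftrightarrow> is_trigraph G \<and> (\<forall>v \<in> verts G. card {e \<in> red G. v \<in> e} \<le> d)"

definition contract :: "'a trigraph \<Rightarrow> 'a \<Rightarrow> 'a \<Rightarrow> 'a \<Rightarrow> 'a trigraph" where
  "contract G u v w =
     \<lparr> verts = insert w (verts G - {u, v}),
       black = {e \<in> black G. u \<notin> e \<and> v \<notin> e}
         \<union> {{w, x} | x. x \<in> nbrs G u \<inter> nbrs G v \<and> {u, x} \<in> black G \<and> {v, x} \<in> black G},
       red = {e \<in> red G. u \<notin> e \<and> v \<notin> e}
         \<union> {{w, x} | x. x \<in> (nbrs G u - nbrs G v) \<union> (nbrs G v - nbrs G u) \<and> x \<noteq> u \<and> x \<noteq> v}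
         \<union> {{w, x} | x. x \<in> nbrs G u \<inter> nbrs G v \<and> \<not> ({u, x} \<in> black G \<and> {v, x} \<in> black G)} \<rparr>"

text \<open>The merged vertex only has to differ from the surviving vertices. It may reuse the name of
  one of the two removed vertices, which gives the same trigraph up to isomorphism and ensures that
  contractions exist even when the vertex type is finite and has no unused element.\<close>

definition contraction :: "'a trigraph \<Rightarrow> 'a trigraph \<Rightarrow> bool" where
  "contraction G G' \<longleftrightarrow>
     (\<exists>u v w. u \<in> verts G \<and> v \<in> verts G \<and> u \<noteq> v \<and> w \<notin> verts G - {u, v} \<and> G' = contract G u v w)"

definition is_K1 :: "'a trigraph \<Rightarrow> bool" where
  "is_K1 G \<longleftrightarrow> (\<exists>w. G = \<lparr> verts = {w}, black = {}, red = {} \<rparr>)"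

definition d_sequence :: "nat \<Rightarrow> 'a trigraph \<Rightarrow> (nat \<Rightarrow> 'a trigraph) \<Rightarrow> bool" where
  "d_sequence d G S \<longleftrightarrow>
     S (card (verts G)) = G \<and> is_K1 (S 1) \<and>
     (\<forall>i \<in> {1..card (verts G)}. d_trigraph d (S i)) \<and>
     (\<forall>i \<in> {2..card (verts G)}. contraction (S i) (S (i - 1)))"

text \<open>Every nonempty graph admits a \<open>d\<close>-sequence for some \<open>d\<close>
  (see \<open>d_sequence_exists\<close> below), so the minimum is attained.\<close>

definition tww :: "'a trigraph \<Rightarrow> nat" where
  "tww G = (LEAST d. \<exists>S. d_sequence d G S)"

definition modular_product :: "'a trigraph \<Rightarrow> 'b trigraph \<Rightarrow> ('a \<times> 'b) trigraph"
    (infixl "\<diamond>" 70) where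
  "G \<diamond> H =
     \<lparr> verts = verts G \<times> verts H,
       black = {{(u, i), (v, j)} | u i v j.
         u \<in> verts G \<and> v \<in> verts G \<and> i \<in> verts H \<and> j \<in> verts H \<and> u \<noteq> v \<and> i \<noteq> j \<and>
         ({u, v} \<in> black G \<and> {i, j} \<in> black H \<or> {u, v} \<notin> black G \<and> {i, j} \<notin> black H)},
       red = {} \<rparr>"

definition path_graph :: "nat \<Rightarrow> nat trigraph" where
  "path_graph n =
     \<lparr> verts = {1..n}, black = {{i, i + 1} | i. 1 \<le> i \<and> i < n}, red = {} \<rparr>"

lemma is_graph_path_graph: "is_graph (path_graph n)"
  unfolding is_graph_def is_trigraph_def path_graph_def by force

lemma is_graph_modular_product:
  assumes "is_graph G" "is_graph H"
  shows "is_graph (G \<diamond> H)"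
  using assms unfolding is_graph_def is_trigraph_def modular_product_def by auto

lemma is_trigraph_contraction:
  assumes G: "is_trigraph G" and c: "contraction G G'"
  shows "is_trigraph G'" and "Suc (card (verts G')) = card (verts G)"
proof -
  from c obtain u v w where uv: "u \<in> verts G" "v \<in> verts G" "u \<noteq> v"
    and w: "w \<notin> verts G - {u, v}" and G': "G' = contract G u v w"
    unfolding contraction_def by blast
  have fin: "finite (verts G)" and dis: "black G \<inter> red G = {}"
    and b: "\<And>e. e \<in> black G \<Longrightarrow> \<exists>x y. e = {x, y} \<and> x \<in> verts G \<and> y \<in> verts G \<and> x \<noteq> y"
    and r: "\<And>e. e \<in> red G \<Longrightarrow> \<exists>x y. e = {x, y} \<and> x \<in> verts G \<and> y \<in> verts G \<and> x \<noteq> y"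
    using G unfolding is_trigraph_def by auto
  have loop: "{x} \<notin> black G \<union> red G" for x
    using b[of "{x}"] r[of "{x}"] by (auto simp: doubleton_eq_iff)
  have ne: "x \<noteq> u \<and> x \<noteq> v \<and> x \<noteq> w \<and> x \<in> verts G"
    if "x \<in> nbrs G u \<inter> nbrs G v" for x
    using that w loop unfolding nbrs_def by auto
  have ne': "x \<noteq> w \<and> x \<in> verts G"
    if "x \<in> nbrs G u \<union> nbrs G v" "x \<noteq> u" "x \<noteq> v" for x
    using that w unfolding nbrs_def by auto
  have old: "w \<notin> e" if "e \<in> black G \<union> red G" "u \<notin> e" "v \<notin> e" for e
    using that w b[of e] r[of e] by blast
  let ?P = "{{x, y} | x y. x \<in> verts G' \<and> y \<in> verts G' \<and> x \<noteq> y}"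
  have new: "{w, x} \<in> ?P" if "x \<in> verts G" "x \<noteq> u" "x \<noteq> v" "x \<noteq> w" for x
    using that unfolding G' contract_def by auto
  have keep: "e \<in> ?P" if e: "e \<in> black G \<union> red G" "u \<notin> e" "v \<notin> e" for e
  proof -
    obtain x y where "e = {x, y}" "x \<in> verts G" "y \<in> verts G" "x \<noteq> y"
      using e(1) b[of e] r[of e] by blast
    then show ?thesis using e(2,3) unfolding G' contract_def by auto
  qed
  have B: "black G' \<subseteq> ?P"
  proof
    fix e assume "e \<in> black G'"
    then consider "e \<in> black G" "u \<notin> e" "v \<notin> e"
      | x where "e = {w, x}" "x \<in> nbrs G u \<inter> nbrs G v"
      unfolding G' contract_def by auto
    then show "e \<in> ?P" by cases (use keep new ne in blast)+
  qed
  have R: "red G' \<subseteq> ?P"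
  proof
    fix e assume "e \<in> red G'"
    then consider "e \<in> red G" "u \<notin> e" "v \<notin> e"
      | x where "e = {w, x}" "x \<in> nbrs G u \<union> nbrs G v" "x \<noteq> u" "x \<noteq> v"
      | x where "e = {w, x}" "x \<in> nbrs G u \<inter> nbrs G v"
      unfolding G' contract_def by auto
    then show "e \<in> ?P"
    proof cases
      case 1
      then show ?thesis by (intro keep) auto
    next
      case (2 x)
      then show ?thesis using ne'[of x] new[of x] by simp
    next
      case (3 x)
      then show ?thesis using ne[of x] new[of x] by simp
    qed
  qed
  have D: "black G' \<inter> red G' = {}"
  proof -
    have False if e: "e \<in> black G'" "e \<in> red G'" for e
    proof (cases "w \<in> e")
      case False
      then show ?thesis using e dis unfolding G' contract_def by auto
    next
      case True
      then obtain x where x: "e = {w, x}" "x \<in> nbrs G u \<inter> nbrs G v"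
          "{u, x} \<in> black G" "{v, x} \<in> black G"
        using e(1) old[of e] unfolding G' contract_def by auto
      have "\<not> (e \<in> red G \<and> u \<notin> e \<and> v \<notin> e)"
        using True old[of e] by blast
      then obtain y where y: "e = {w, y}"
          "y \<notin> nbrs G u \<inter> nbrs G v \<or> \<not> ({u, y} \<in> black G \<and> {v, y} \<in> black G)"
        using e(2) unfolding G' contract_def by auto
      have "x = y" using x y by (auto simp: doubleton_eq_iff)
      then show False using x y by blast
    qed
    then show ?thesis by blast
  qed
  show "is_trigraph G'"
    using B R D fin unfolding is_trigraph_def by (auto simp: G' contract_def)
  have "card {u, v} \<le> card (verts G)"
    by (rule card_mono) (use fin uv in auto)
  then have "2 \<le> card (verts G)" using uv by simp
  moreover have "card (verts G - {u, v}) = card (verts G) - 2"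
    using fin uv by (simp add: card_Diff_subset)
  ultimately show "Suc (card (verts G')) = card (verts G)"
    using fin w by (simp add: G' contract_def)
qed

lemma red_degree_bound:
  assumes "is_trigraph G"
  shows "d_trigraph (card (Pow (verts G))) G"
proof -
  have "red G \<subseteq> Pow (verts G)" and "finite (verts G)"
    using assms unfolding is_trigraph_def by auto
  then have "card {e \<in> red G. v \<in> e} \<le> card (Pow (verts G))" for v
    by (intro card_mono) auto
  then show ?thesis using assms unfolding d_trigraph_def by blast
qed

lemma d_trigraph_mono: "d_trigraph d G \<Longrightarrow> d \<le> d' \<Longrightarrow> d_trigraph d' G"
  unfolding d_trigraph_def by (meson order_trans)

lemma d_sequence_exists_trigraph:
  assumes "is_trigraph G" "card (verts G) = Suc n"
  shows "\<exists>d S. d_sequence d G S"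
  using assms
proof (induction n arbitrary: G)
  case 0
  then obtain w where w: "verts G = {w}" by (auto simp: card_Suc_eq)
  have "black G = {}" "red G = {}"
    using 0(1) w unfolding is_trigraph_def by auto
  then have "is_K1 G" using w unfolding is_K1_def by (intro exI[of _ w]) (cases G, auto)
  then have "d_sequence (card (Pow (verts G))) G (\<lambda>_. G)"
    using red_degree_bound[OF 0(1)] 0 unfolding d_sequence_def by auto
  then show ?case by blast
next
  case (Suc n)
  obtain u v where uv: "u \<in> verts G" "v \<in> verts G" "u \<noteq> v"
    using Suc.prems(2) by (metis card_Suc_eq insertCI)
  have c: "contraction G (contract G u v u)"
    using uv unfolding contraction_def by blast
  let ?G = "contract G u v u"
  have tri: "is_trigraph ?G" and card: "card (verts ?G) = Suc n"
    using is_trigraph_contraction[OF Suc.prems(1) c] Suc.prems(2) by auto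
  obtain d S where S: "d_sequence d ?G S" using Suc.IH[OF tri card] by blast
  define d' where "d' = max d (card (Pow (verts G)))"
  define S' where "S' = S(Suc (Suc n) := G)"
  have dG: "d_trigraph d' G"
    using red_degree_bound[OF Suc.prems(1)] by (rule d_trigraph_mono) (simp add: d'_def)
  have dS: "d_trigraph d' (S i)" if "i \<in> {1..Suc n}" for i
  proof (rule d_trigraph_mono)
    show "d_trigraph d (S i)" using S that card unfolding d_sequence_def by auto
  qed (simp add: d'_def)
  have "d_sequence d' G S'"
    using S c dG dS card Suc.prems(2) unfolding d_sequence_def S'_def
    by (auto simp: le_Suc_eq)
  then show ?case by blast
qed

lemma d_sequence_exists:
  assumes "is_graph G" "verts G \<noteq> {}"
  shows "\<exists>d S. d_sequence d G S"
proof -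
  have "finite (verts G)" using assms unfolding is_graph_def is_trigraph_def by blast
  then have "card (verts G) = Suc (card (verts G) - 1)"
    using assms(2) by (simp add: card_gt_0_iff)
  then show ?thesis
    using assms d_sequence_exists_trigraph unfolding is_graph_def by blast
qed

end

theory Submission
  imports Defs
begin

text \<open>The very first contraction already creates a vertex of large red degree: it merges two
  vertices \<open>(u, i)\<close> and \<open>(u', i')\<close> of the product, whose neighbourhoods differ in at least
  \<open>n + 1\<close> further vertices. If \<open>i = i'\<close>, some column \<open>v\<close> other than \<open>u\<close> and \<open>u'\<close> distinguishes \<open>u\<close>
  from \<open>u'\<close> and contributes \<open>n - 1\<close> vertices, and the columns \<open>u\<close> and \<open>u'\<close> contribute at least one
  each; \<open>u = u'\<close> is symmetric. Otherwise let \<open>a\<close> be the number of columns other than \<open>u\<close> and \<open>u'\<close>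
  that distinguish \<open>u\<close> from \<open>u'\<close>, and \<open>b\<close> the number of rows other than \<open>i\<close> and \<open>i'\<close> that distinguish
  \<open>i\<close> from \<open>i'\<close>. The distinguishing columns contribute \<open>n - 1 - b\<close> vertices each and the
  other \<open>n - 2 - a\<close> at least \<open>b\<close> each. As \<open>a\<close> and \<open>b\<close> lie between \<open>1\<close> and \<open>4\<close>, this suffices for
  \<open>n \<ge> 7\<close>. The cases \<open>n = 5\<close> and \<open>n = 6\<close>, where the columns \<open>u\<close> and \<open>u'\<close> matter, are finite checks.\<close>

text \<open>A vertex other than \<open>u\<close> and \<open>v\<close> joined to exactly one of them
  gets a red edge to the merged vertex, so one contraction already forces red degree at least
  \<open>k\<close>.\<close>

lemma tww_ge_neighbourhood_difference:
  assumes G: "is_graph G" and two: "card (verts G) \<ge> 2"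
    and diff: "\<And>u v. u \<in> verts G \<Longrightarrow> v \<in> verts G \<Longrightarrow> u \<noteq> v \<Longrightarrow>
      k \<le> card ((nbrs G u - nbrs G v) \<union> (nbrs G v - nbrs G u) - {u, v})"
  shows "k \<le> tww G"
proof -
  have "verts G \<noteq> {}" using two by auto
  then have "\<exists>d S. d_sequence d G S" using d_sequence_exists[OF G] by blast
  then have "\<exists>S. d_sequence (tww G) G S" unfolding tww_def by (rule LeastI_ex)
  then obtain S where S: "d_sequence (tww G) G S" by blast
  let ?N = "card (verts G)"
  \<comment> \<open>Two vertices guarantee that a first contraction takes place and that its result
    belongs to the sequence.\<close>
  have N: "?N \<in> {2..?N}" "?N - 1 \<in> {1..?N}" using two by auto
  then have "contraction (S ?N) (S (?N - 1))" and "S ?N = G"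
    and d: "d_trigraph (tww G) (S (?N - 1))"
    using S unfolding d_sequence_def by blast+
  then obtain u v w where uv: "u \<in> verts G" "v \<in> verts G" "u \<noteq> v"
    and G': "S (?N - 1) = contract G u v w"
    unfolding contraction_def by auto
  let ?D = "(nbrs G u - nbrs G v) \<union> (nbrs G v - nbrs G u) - {u, v}"
  let ?R = "{e \<in> red (contract G u v w). w \<in> e}"
  have "is_trigraph (contract G u v w)" using d G' unfolding d_trigraph_def by simp
  then have "red (contract G u v w) \<subseteq> Pow (verts (contract G u v w))"
    and "finite (verts (contract G u v w))"
    unfolding is_trigraph_def by auto
  then have fin: "finite ?R" by (auto intro: finite_subset)
  have sub: "(\<lambda>x. {w, x}) ` ?D \<subseteq> ?R" unfolding contract_def by auto
  have "inj_on (\<lambda>x. {w, x}) ?D" by (auto simp: inj_on_def doubleton_eq_iff)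
  then have "card ?D \<le> card ?R" using sub fin by (rule card_inj_on_le)
  also have "w \<in> verts (contract G u v w)" unfolding contract_def by simp
  then have "card ?R \<le> tww G" using d G' unfolding d_trigraph_def by simp
  finally show ?thesis using diff[OF uv] by simp
qed

text \<open>No bound \<open>n\<close> occurs: this is the path on all naturals, which induces
  \<open>path_graph n\<close> on \<open>{1..n}\<close>.\<close>

definition adj :: "nat \<Rightarrow> nat \<Rightarrow> bool" where
  "adj u v \<longleftrightarrow> v = Suc u \<or> u = Suc v"

definition prod_adj :: "nat \<times> nat \<Rightarrow> nat \<times> nat \<Rightarrow> bool" where
  "prod_adj p q \<longleftrightarrow> fst p \<noteq> fst q \<and> snd p \<noteq> snd q \<and> (adj (fst p) (fst q) = adj (snd p) (snd q))"

definition prod_diff :: "nat \<Rightarrow> nat \<times> nat \<Rightarrow> nat \<times> nat \<Rightarrow> (nat \<times> nat) set" where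
  "prod_diff n p q =
    {r \<in> {1..n} \<times> {1..n}. r \<noteq> p \<and> r \<noteq> q \<and> prod_adj p r \<noteq> prod_adj q r}"

lemma black_path_graph:
  assumes "u \<in> {1..n}" "v \<in> {1..n}"
  shows "{u, v} \<in> black (path_graph n) \<longleftrightarrow> adj u v"
  using assms unfolding path_graph_def adj_def by (auto simp: doubleton_eq_iff)

lemma nbrs_modular_product_path:
  assumes "p \<in> {1..n} \<times> {1..n}"
  shows "nbrs (path_graph n \<diamond> path_graph n) p = {r \<in> {1..n} \<times> {1..n}. prod_adj p r}"
proof -
  have V: "verts (path_graph n) = {1..n}" by (simp add: path_graph_def)
  have comm: "adj x y = adj y x" for x y by (auto simp: adj_def)
  have "{p, r} \<in> black (path_graph n \<diamond> path_graph n) \<longleftrightarrow> prod_adj p r" (is "?L \<longleftrightarrow> _")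
    if r: "r \<in> {1..n} \<times> {1..n}" for r
  proof
    assume ?L
    then show "prod_adj p r"
      using comm unfolding modular_product_def prod_adj_def
      by (auto simp: V black_path_graph doubleton_eq_iff)
  next
    assume "prod_adj p r"
    then show ?L
      using assms r unfolding modular_product_def prod_adj_def
      by (cases p; cases r) (fastforce simp: V black_path_graph)
  qed
  moreover have "verts (path_graph n \<diamond> path_graph n) = {1..n} \<times> {1..n}"
    and "red (path_graph n \<diamond> path_graph n) = {}"
    by (simp_all add: modular_product_def V)
  ultimately show ?thesis unfolding nbrs_def by auto
qed

definition path_diff :: "nat \<Rightarrow> nat \<Rightarrow> nat \<Rightarrow> nat set" where
  "path_diff n u u' = {v \<in> {1..n} - {u, u'}. adj u v \<noteq> adj u' v}"

lemma finite_path_diff [simp]: "finite (path_diff n u u')"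
  by (simp add: path_diff_def)

text \<open>For \<open>u < u'\<close>, the right neighbour of \<open>u'\<close> or the left
  neighbour of \<open>u\<close> works, unless both are ends of the path; then 2 works, being too far
  from \<open>n\<close>.\<close>

lemma path_diff_nonempty:
  assumes "n \<ge> 5" "u \<in> {1..n}" "u' \<in> {1..n}" "u \<noteq> u'"
  shows "path_diff n u u' \<noteq> {}"
  using assms
proof (induction u u' rule: linorder_wlog)
  case (le u u')
  consider "u' < n" | "u' = n" "u > 1" | "u' = n" "u = 1" using le by force
  then have "\<exists>v. v \<in> path_diff n u u'"
  proof cases
    case 1
    then show ?thesis using le by (intro exI[of _ "Suc u'"]) (auto simp: path_diff_def adj_def)
  next
    case 2
    then show ?thesis using le by (intro exI[of _ "u - 1"]) (auto simp: path_diff_def adj_def)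
  next
    case 3
    then show ?thesis using le by (intro exI[of _ 2]) (auto simp: path_diff_def adj_def)
  qed
  then show ?case by blast
next
  case (sym u u')
  then show ?case by (auto simp: path_diff_def)
qed

lemma card_path_diff_le: "card (path_diff n u u') \<le> 4"
proof -
  have "path_diff n u u' \<subseteq> set [u - 1, u + 1, u' - 1, u' + 1]"
    by (auto simp: path_diff_def adj_def)
  then have "card (path_diff n u u') \<le> card (set [u - 1, u + 1, u' - 1, u' + 1])"
    by (intro card_mono) auto
  also have "\<dots> \<le> 4" using card_length[of "[u - 1, u + 1, u' - 1, u' + 1]"] by simp
  finally show ?thesis .
qed

lemma finite_column [simp]: "finite {j. (v, j) \<in> prod_diff n p q}"
  by (rule finite_subset[of _ "{1..n}"]) (auto simp: prod_diff_def)

lemma card_prod_diff_columns: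
  "card (prod_diff n p q) = (\<Sum>v\<in>{1..n}. card {j. (v, j) \<in> prod_diff n p q})"
proof -
  have "card (prod_diff n p q) = card (Sigma {1..n} (\<lambda>v. {j. (v, j) \<in> prod_diff n p q}))"
    by (rule arg_cong[where f = card]) (auto simp: prod_diff_def)
  also have "\<dots> = (\<Sum>v\<in>{1..n}. card {j. (v, j) \<in> prod_diff n p q})"
    by (rule card_SigmaI) auto
  finally show ?thesis .
qed

lemma card_prod_diff_same_row:
  assumes "n \<ge> 5" "u \<in> {1..n}" "u' \<in> {1..n}" "u \<noteq> u'" "i \<in> {1..n}"
  shows "n + 1 \<le> card (prod_diff n (u, i) (u', i))"
proof -
  let ?c = "\<lambda>v. {j. (v, j) \<in> prod_diff n (u, i) (u', i)}"
  obtain v where v: "v \<in> path_diff n u u'" using path_diff_nonempty[OF assms(1-4)] by blast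
  have "{1..n} - {i} \<subseteq> ?c v"
    using v by (auto simp: path_diff_def prod_diff_def prod_adj_def)
  then have "card ({1..n} - {i}) \<le> card (?c v)" by (intro card_mono) auto
  then have cv: "n - 1 \<le> card (?c v)" using assms(5) by simp
  \<comment> \<open>Columns \<open>u\<close> and \<open>u'\<close> may call for a neighbour or a
    non-neighbour of \<open>i\<close>. For the latter, 5 or 1 is at distance at least two.\<close>
  have row: "\<exists>j\<in>{1..n}. j \<noteq> i \<and> adj i j = b" for b
  proof -
    have "\<exists>j. j \<in> {1..n} \<and> j \<noteq> i \<and> adj i j" if "i < n"
      using that assms(5) by (intro exI[of _ "Suc i"]) (auto simp: adj_def)
    moreover have "\<exists>j. j \<in> {1..n} \<and> j \<noteq> i \<and> adj i j" if "\<not> i < n"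
      using that assms(1,5) by (intro exI[of _ "i - 1"]) (auto simp: adj_def)
    moreover have "\<exists>j. j \<in> {1..n} \<and> j \<noteq> i \<and> \<not> adj i j" if "i \<le> 2"
      using that assms(1) by (intro exI[of _ 5]) (auto simp: adj_def)
    moreover have "\<exists>j. j \<in> {1..n} \<and> j \<noteq> i \<and> \<not> adj i j" if "\<not> i \<le> 2"
      using that assms(1) by (intro exI[of _ 1]) (auto simp: adj_def)
    ultimately show ?thesis by (cases b) blast+
  qed
  \<comment> \<open>As \<open>(u, j)\<close> is never adjacent to \<open>(u, i)\<close>, it counts
    once it is adjacent to \<open>(u', i)\<close>.\<close>
  obtain j where "j \<in> {1..n}" "j \<noteq> i" "adj i j = adj u' u" using row by blast
  then have "j \<in> ?c u" using assms by (auto simp: prod_diff_def prod_adj_def)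
  then have cu: "1 \<le> card (?c u)" by (auto simp: Suc_le_eq card_gt_0_iff)
  obtain j where "j \<in> {1..n}" "j \<noteq> i" "adj i j = adj u u'" using row by blast
  then have "j \<in> ?c u'" using assms by (auto simp: prod_diff_def prod_adj_def)
  then have cu': "1 \<le> card (?c u')" by (auto simp: Suc_le_eq card_gt_0_iff)
  have "n + 1 \<le> (\<Sum>x\<in>{u, u', v}. card (?c x))"
    using cv cu cu' v assms(1,4) by (auto simp: path_diff_def)
  also have "\<dots> \<le> (\<Sum>x\<in>{1..n}. card (?c x))"
    using assms v by (intro sum_mono2) (auto simp: path_diff_def)
  finally show ?thesis by (simp add: card_prod_diff_columns)
qed

text \<open>Exchanging the coordinates preserves \<open>prod_adj\<close>; this reduces the case
  \<open>u = u'\<close> to the case \<open>i = i'\<close>.\<close>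

lemma card_prod_diff_swap:
  "card (prod_diff n (i, u) (i', u')) = card (prod_diff n (u, i) (u', i'))"
proof -
  have "prod_adj (x, y) (x', y') = prod_adj (y, x) (y', x')" for x y x' y'
    by (auto simp: prod_adj_def)
  then have "(j, v) \<in> prod_diff n (i, u) (i', u') \<longleftrightarrow> (v, j) \<in> prod_diff n (u, i) (u', i')" for j v
    unfolding prod_diff_def mem_Collect_eq mem_Times_iff fst_conv snd_conv prod.inject by metis
  then have "bij_betw prod.swap (prod_diff n (i, u) (i', u')) (prod_diff n (u, i) (u', i'))"
    by (intro bij_betw_byWitness[where f' = prod.swap]) auto
  then show ?thesis by (rule bij_betw_same_card)
qed

lemma card_prod_diff_general:
  assumes n: "n \<ge> 7" and u: "u \<in> {1..n}" "u' \<in> {1..n}" "u \<noteq> u'"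
    and i: "i \<in> {1..n}" "i' \<in> {1..n}" "i \<noteq> i'"
  shows "n + 1 \<le> card (prod_diff n (u, i) (u', i'))"
proof -
  let ?c = "\<lambda>v. {j. (v, j) \<in> prod_diff n (u, i) (u', i')}"
  let ?A = "path_diff n u u'" and ?B = "path_diff n i i'"
  define a b where "a = card ?A" and "b = card ?B"
  have ab: "1 \<le> a" "a \<le> 4" "1 \<le> b" "b \<le> 4"
    using path_diff_nonempty[of n] card_path_diff_le[of n] u i n unfolding a_def b_def
    by (simp_all add: Suc_leI card_gt_0_iff)
  have A: "?A \<subseteq> {1..n} - {u, u'}" and B: "?B \<subseteq> {1..n} - {i, i'}"
    by (auto simp: path_diff_def)
  have cA: "n - 1 - b \<le> card (?c v)" if v: "v \<in> ?A" for v
  proof -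
    \<comment> \<open>Since \<open>adj u v\<close> and \<open>adj u' v\<close> differ, exactly one
      of them equals \<open>adj i i'\<close>, so one of \<open>(v, i)\<close> and
      \<open>(v, i')\<close> counts too. It turns \<open>n - 2 - b\<close> into
      \<open>n - 1 - b\<close>.\<close>
    define k where "k = (if adj i i' = adj u v then i' else i)"
    have "adj i' i = adj i i'" by (auto simp: adj_def)
    then have k: "k \<in> {i, i'}" "k \<in> ?c v"
      using v i by (auto simp: k_def path_diff_def prod_diff_def prod_adj_def)
    have "j \<in> ?c v" if "j \<in> {1..n} - {i, i'} - ?B" for j
      using v that by (auto simp: path_diff_def prod_diff_def prod_adj_def)
    then have "insert k ({1..n} - {i, i'} - ?B) \<subseteq> ?c v" using k(2) by blast
    then have "card (insert k ({1..n} - {i, i'} - ?B)) \<le> card (?c v)"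
      by (intro card_mono) auto
    moreover have "card (insert k ({1..n} - {i, i'} - ?B)) = Suc (n - 2 - b)"
      using k i B by (subst card_insert_disjoint) (auto simp: card_Diff_subset b_def)
    ultimately show ?thesis using n ab by simp
  qed
  have cB: "b \<le> card (?c v)" if v: "v \<in> {1..n} - {u, u'} - ?A" for v
  proof -
    have "?B \<subseteq> ?c v"
      using v by (auto simp: path_diff_def prod_diff_def prod_adj_def)
    then show ?thesis unfolding b_def by (intro card_mono) auto
  qed
  have card: "card ({1..n} - {u, u'} - ?A) = n - 2 - a"
    using A u by (simp add: card_Diff_subset a_def)
  have "n + 1 \<le> a * (n - 1 - b) + (n - 2 - a) * b"
  proof -
    \<comment> \<open>With \<open>n = m + 7\<close> no subtraction truncates, and the sixteen pairs
      \<open>(a, b)\<close> leave linear inequalities in \<open>m\<close>.\<close>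
    obtain m where m: "n = m + 7" using n by (metis add.commute le_Suc_ex)
    have "a \<in> {1, 2, 3, 4}" "b \<in> {1, 2, 3, 4}" using ab by auto
    then show ?thesis unfolding m by auto
  qed
  also have "\<dots> \<le> (\<Sum>v\<in>?A. card (?c v)) + (\<Sum>v\<in>{1..n} - {u, u'} - ?A. card (?c v))"
    using sum_bounded_below[of ?A "n - 1 - b" "\<lambda>v. card (?c v)", OF cA]
      sum_bounded_below[of "{1..n} - {u, u'} - ?A" b "\<lambda>v. card (?c v)", OF cB] card
    by (simp add: a_def)
  also have "\<dots> = (\<Sum>v\<in>{1..n} - {u, u'}. card (?c v))"
    using sum.subset_diff[OF A, of "\<lambda>v. card (?c v)"] by simp
  also have "\<dots> \<le> (\<Sum>v\<in>{1..n}. card (?c v))" by (intro sum_mono2) auto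
  finally show ?thesis by (simp add: card_prod_diff_columns)
qed

text \<open>An executable form of the cardinality, for evaluation by
  \<open>code_simp\<close>.\<close>

definition count_prod_diff :: "nat \<Rightarrow> nat \<times> nat \<Rightarrow> nat \<times> nat \<Rightarrow> nat" where
  "count_prod_diff n p q = length (filter
    (\<lambda>r. r \<noteq> p \<and> r \<noteq> q \<and> prod_adj p r \<noteq> prod_adj q r) (List.product [1..<Suc n] [1..<Suc n]))"

lemma card_prod_diff_eq_count: "card (prod_diff n p q) = count_prod_diff n p q"
proof -
  have "prod_diff n p q = set (filter
    (\<lambda>r. r \<noteq> p \<and> r \<noteq> q \<and> prod_adj p r \<noteq> prod_adj q r) (List.product [1..<Suc n] [1..<Suc n]))"
    by (auto simp: prod_diff_def)
  then show ?thesis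
    unfolding count_prod_diff_def
    by (simp only: distinct_card distinct_filter distinct_product distinct_upt)
qed

text \<open>Stated with disjunctions, which \<open>code_simp\<close> evaluates lazily, unlike implications.\<close>

lemma count_prod_diff_small:
  "\<forall>n\<in>set [5, 6]. \<forall>u\<in>set [1..<Suc n]. \<forall>u'\<in>set [1..<Suc n]. u' \<le> u \<or>
    (\<forall>i\<in>set [1..<Suc n]. \<forall>i'\<in>set [1..<Suc n]. i = i' \<or>
      n + 1 \<le> count_prod_diff n (u, i) (u', i'))"
  by code_simp

lemma card_prod_diff:
  assumes n: "n \<ge> 5" and pq: "p \<in> {1..n} \<times> {1..n}" "q \<in> {1..n} \<times> {1..n}" "p \<noteq> q"
  shows "n + 1 \<le> card (prod_diff n p q)"
proof -
  obtain u i u' i' where [simp]: "p = (u, i)" "q = (u', i')" by (cases p; cases q)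
  have u: "u \<in> {1..n}" "u' \<in> {1..n}" and i: "i \<in> {1..n}" "i' \<in> {1..n}" using pq by auto
  consider "i = i'" | "u = u'" | "u \<noteq> u'" "i \<noteq> i'" "n \<ge> 7" | "u \<noteq> u'" "i \<noteq> i'" "n \<in> {5, 6}"
    using n by force
  then show ?thesis
  proof cases
    case 1
    then show ?thesis using card_prod_diff_same_row[of n u u' i] n u i pq by auto
  next
    case 2
    then show ?thesis
      using card_prod_diff_same_row[of n i i' u] n u i pq by (auto simp: card_prod_diff_swap)
  next
    case 3
    then show ?thesis using card_prod_diff_general u i by simp
  next
    case 4
    \<comment> \<open>The evaluated check covers only \<open>u < u'\<close>; symmetry in
      \<open>p\<close> and \<open>q\<close> supplies the rest.\<close>
    have comm: "prod_diff n p q = prod_diff n q p" by (auto simp: prod_diff_def)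
    have small: "n + 1 \<le> card (prod_diff n (x, j) (y, k))"
      if "x \<in> {1..n}" "y \<in> {1..n}" "j \<in> {1..n}" "k \<in> {1..n}" "x < y" "j \<noteq> k" for x y j k
    proof -
      have "n \<in> set [5, 6]" "x \<in> set [1..<Suc n]" "y \<in> set [1..<Suc n]"
        "j \<in> set [1..<Suc n]" "k \<in> set [1..<Suc n]"
        using that 4(3) by auto
      then have "y \<le> x \<or> j = k \<or> n + 1 \<le> count_prod_diff n (x, j) (y, k)"
        using count_prod_diff_small by blast
      then show ?thesis using that by (simp add: card_prod_diff_eq_count)
    qed
    show ?thesis
    proof (cases "u < u'")
      case True
      then show ?thesis using small[of u u' i i'] u i 4 by simp
    next
      case False
      then show ?thesis using small[of u' u i' i] u i 4 comm by simp
    qed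
  qed
qed

theorem theorem3p12:
  fixes n :: nat
  assumes "n \<ge> 5"
  shows "tww (path_graph n \<diamond> path_graph n) \<ge> n + 1"
proof (rule tww_ge_neighbourhood_difference)
  let ?G = "path_graph n \<diamond> path_graph n"
  show "is_graph ?G" by (intro is_graph_modular_product is_graph_path_graph)
  have V: "verts ?G = {1..n} \<times> {1..n}" by (simp add: modular_product_def path_graph_def)
  have "2 * 1 \<le> n * n" using assms by (intro mult_le_mono) auto
  then show "card (verts ?G) \<ge> 2" by (simp add: V)
  fix p q assume pq: "p \<in> verts ?G" "q \<in> verts ?G" "p \<noteq> q"
  then have "(nbrs ?G p - nbrs ?G q) \<union> (nbrs ?G q - nbrs ?G p) - {p, q} = prod_diff n p q"
    by (auto simp: V nbrs_modular_product_path prod_diff_def)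
  then show "n + 1 \<le> card ((nbrs ?G p - nbrs ?G q) \<union> (nbrs ?G q - nbrs ?G p) - {p, q})"
    using card_prod_diff[OF assms] pq V by simp
qed

end
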